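(* For $P=(v_2,v_6,v_1,v_3,v_5)^\top\in\mathbb{R}^5$ and $v_0\in\mathbb{R}$, let $\mathcal{A}$ denote the fourth order four dimensional Hankel tensor with generating vector $(v_0,v_1,v_2,v_3,1,v_5,v_6,v_5,1,v_3,v_2,v_1,v_0)^\top$. Then there are two real-valued functions $M_0(v_2,v_6,v_1,v_3,v_5)\ge N_0(v_2,v_6,v_1,v_3,v_5)>0$, defined for all $(v_2,v_6,v_1,v_3,v_5)^\top\in\mathbb{R}^5$ with $\eta(v_5,v_6)<1$, such that for every such point and every $v_0\in\mathbb{R}$: $\mathcal{A}$ is SOS if and only if $v_0\ge M_0(v_2,v_6,v_1,v_3,v_5)$, and $\mathcal{A}$ is PSD if and only if $v_0\ge N_0(v_2,v_6,v_1,v_3,v_5)$. Moreover, if $M_0(v_2,v_6,v_1,v_3,v_5)=N_0(v_2,v_6,v_1,v_3,v_5)$ for all $(v_2,v_6,v_1,v_3,v_5)^\top\in\mathbb{R}^5$ with $\eta(v_5,v_6)<1$, then there is no PNS fourth order four dimensional Hankel tensor whose generating vector $(v_0,\ldots,v_{12})^\top\in\mathbb{R}^{13}$ satisfies $v_j=v_{12-j}$ for $j=0,\ldots,5$.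
   Context: A fourth order four dimensional Hankel tensor $\mathcal{A}=(a_{i_1i_2i_3i_4})$ with generating vector $\mathbf{v}=(v_0,\ldots,v_{12})^\top\in\mathbb{R}^{13}$ is defined by $a_{i_1i_2i_3i_4}=v_{i_1+i_2+i_3+i_4-4}$ for $i_1,i_2,i_3,i_4\in\{1,2,3,4\}$. Its associated polynomial is $f(\mathbf{x})=\sum_{i_1,i_2,i_3,i_4=1}^4 v_{i_1+i_2+i_3+i_4-4}\,x_{i_1}x_{i_2}x_{i_3}x_{i_4}$, $\mathbf{x}\in\mathbb{R}^4$. $\mathcal{A}$ is PSD (positive semi-definite) if $f(\mathbf{x})\ge 0$ for all $\mathbf{x}\in\mathbb{R}^4$; it is SOS (sum-of-squares) if $f$ is a sum of squares of real quadratic homogeneous polynomials; it is PNS if it is PSD but not SOS. The function $\eta:\mathbb{R}^2\to\mathbb{R}$ is defined by $\eta(\beta,\gamma)=4|\beta|-3\gamma$ if $\gamma\le|\beta|$, and $\eta(\beta,\gamma)=\frac{3\gamma-\sqrt{9\gamma^2-8\beta^2}}{2}$ if $\gamma>|\beta|$. *)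

theory Defs
  imports "HOL-Analysis.Analysis"
begin

text \<open>
  A fourth order four dimensional tensor is given by its entries at indices in \<open>{1..4}\<close>;
  values at other indices are irrelevant.  The coordinate \<open>x\<^sub>i\<close> of \<open>x :: real^4\<close>
  is \<open>x $ of_nat i\<close>.  In the index type \<open>4\<close> one has \<open>of_nat 4 = 0\<close>, so \<open>of_nat\<close> is a
  bijection from \<open>{1..4}\<close> onto the index type.
\<close>

type_synonym tensor4 = "nat \<Rightarrow> nat \<Rightarrow> nat \<Rightarrow> nat \<Rightarrow> real"

lemma bij_betw_of_nat_4: "bij_betw (of_nat :: nat \<Rightarrow> 4) {1..4} UNIV"
proof -
  have "{1..4::nat} = {1, 2, 3, 4}" by auto
  then have "(of_nat :: nat \<Rightarrow> 4) ` {1..4} = UNIV"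
    by (simp only: image_insert image_empty of_nat_numeral of_nat_1 UNIV_4)
  moreover have "card {1..4::nat} = card (UNIV :: 4 set)" by simp
  ultimately show ?thesis
    by (metis bij_betw_def eq_card_imp_inj_on finite_atLeastAtMost)
qed

text \<open>The generating vector is a list \<open>[v\<^sub>0, \<dots>, v\<^sub>1\<^sub>2]\<close> of length 13.\<close>

definition hankel_tensor :: "real list \<Rightarrow> tensor4" where
  "hankel_tensor v i1 i2 i3 i4 = v ! (i1 + i2 + i3 + i4 - 4)"

definition tensor_poly :: "tensor4 \<Rightarrow> real^4 \<Rightarrow> real" where
  "tensor_poly A x =
     (\<Sum>i1 = 1..4. \<Sum>i2 = 1..4. \<Sum>i3 = 1..4. \<Sum>i4 = 1..4.
        A i1 i2 i3 i4 * x $ of_nat i1 * x $ of_nat i2 * x $ of_nat i3 * x $ of_nat i4)"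

definition PSD :: "tensor4 \<Rightarrow> bool" where
  "PSD A \<longleftrightarrow> (\<forall>x. tensor_poly A x \<ge> 0)"

text \<open>
  Polynomials over the infinite field \<open>\<real>\<close> are identified with their polynomial functions.
\<close>

definition homogeneous_quadratic :: "(real^4 \<Rightarrow> real) \<Rightarrow> bool" where
  "homogeneous_quadratic q \<longleftrightarrow>
     (\<exists>b :: nat \<Rightarrow> nat \<Rightarrow> real. \<forall>x.
        q x = (\<Sum>i = 1..4. \<Sum>j = 1..4. b i j * x $ of_nat i * x $ of_nat j))"

definition SOS :: "tensor4 \<Rightarrow> bool" where
  "SOS A \<longleftrightarrow>
     (\<exists>qs. (\<forall>q \<in> set qs. homogeneous_quadratic q) \<and>
           (\<forall>x. tensor_poly A x = (\<Sum>q\<leftarrow>qs. (q x)\<^sup>2)))"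

definition PNS :: "tensor4 \<Rightarrow> bool" where
  "PNS A \<longleftrightarrow> PSD A \<and> \<not> SOS A"

definition eta :: "real \<Rightarrow> real \<Rightarrow> real" where
  "eta \<beta> \<gamma> =
     (if \<gamma> \<le> \<bar>\<beta>\<bar> then 4 * \<bar>\<beta>\<bar> - 3 * \<gamma>
      else (3 * \<gamma> - sqrt (9 * \<gamma>\<^sup>2 - 8 * \<beta>\<^sup>2)) / 2)"

end

theory Submission
  imports Defs
begin

text \<open>
  For fixed other entries, the sets of \<open>v\<^sub>0\<close> making the tensor SOS or PSD are closed and
  upward closed, and \<open>M\<^sub>0\<close>, \<open>N\<^sub>0\<close> are their minima.  Closedness of the SOS cone follows from
  compactness: the Gram tensors of sums of squares with bounded values are bounded, and form multiples
  of elements of the convex hull of a compact set.  The condition \<open>\<eta>(v\<^sub>5, v\<^sub>6) < 1\<close> says that the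
  form restricted to \<open>x\<^sub>1 = x\<^sub>4 = 0\<close> is positive definite; that restriction is then a sum of squares
  with room to spare, and all mixed monomials are absorbed by this slack and a large
  \<open>v\<^sub>0 (x\<^sub>1\<^sup>4 + x\<^sub>4\<^sup>4)\<close>.  Finally, any palindromic PSD Hankel tensor is a limit of PSD ones
  which after scaling satisfy \<open>v\<^sub>4 = 1\<close> and \<open>\<eta> < 1\<close>, so the last claim follows from closedness.
\<close>

section \<open>Sums of squares of quadratic forms\<close>

definition quadratic_form :: "real^'n^'n \<Rightarrow> real^'n \<Rightarrow> real" where
  "quadratic_form b x = (\<Sum>i\<in>UNIV. \<Sum>j\<in>UNIV. b $ i $ j * x $ i * x $ j)"

definition sum_of_squares :: "(real^'n \<Rightarrow> real) \<Rightarrow> bool" where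
  "sum_of_squares f \<longleftrightarrow> (\<exists>bs. \<forall>x. f x = (\<Sum>b\<leftarrow>bs. (quadratic_form b x)\<^sup>2))"

lemma quadratic_form_add: "quadratic_form (b + c) x = quadratic_form b x + quadratic_form c x"
  by (simp add: quadratic_form_def sum.distrib algebra_simps)

lemma quadratic_form_scaleR: "quadratic_form (c *\<^sub>R b) x = c * quadratic_form b x"
  by (simp add: quadratic_form_def sum_distrib_left mult.assoc)

lemma quadratic_form_transpose: "quadratic_form (transpose b) x = quadratic_form b x"
  unfolding quadratic_form_def transpose_def
  by (subst sum.swap) (simp add: mult_ac)

lemma quadratic_form_single:
  "quadratic_form (\<chi> k l. if k = i \<and> l = j then 1 else 0) x = x $ i * x $ j"
proof -
  have "(\<Sum>l\<in>UNIV. (if k = i \<and> l = j then 1 else 0) * x $ k * x $ l)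
      = (if k = i then x $ i * x $ j else 0)" for k
    by (cases "k = i") (simp_all add: if_distrib [of "\<lambda>c. c * _"] cong: if_cong)
  then show ?thesis
    by (simp add: quadratic_form_def)
qed

text \<open>For symmetric \<open>b\<close>, expanding \<open>x \<bullet> (b *v x)\<close> at the sum
  and at the difference of two basis vectors leaves a difference of four times the entry.\<close>

lemma polarization:
  assumes "transpose b = b"
  shows "b $ i $ j = (quadratic_form b (axis i 1 + axis j 1) - quadratic_form b (axis i 1 - axis j 1)) / 4"
proof -
  have inner: "quadratic_form b x = x \<bullet> (b *v x)" for x
    by (simp add: quadratic_form_def inner_vec_def matrix_vector_mult_def sum_distrib_left mult_ac)
  have entry: "axis k 1 \<bullet> (b *v axis l 1) = b $ k $ l" for k l
    by (simp add: matrix_vector_mult_basis inner_axis' column_def)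
  have "b $ j $ i = b $ i $ j"
    using assms by (metis transpose_def vec_lambda_beta)
  then show ?thesis
    unfolding inner matrix_vector_right_distrib matrix_vector_mult_diff_distrib inner_add_left inner_add_right
      inner_diff_left inner_diff_right entry
    by simp
qed

lemma sum_of_squares_0: "sum_of_squares (\<lambda>x. 0)"
  unfolding sum_of_squares_def by (rule exI [of _ "[]"]) simp

lemma sum_of_squares_add:
  assumes "sum_of_squares f" "sum_of_squares g"
  shows "sum_of_squares (\<lambda>x. f x + g x)"
proof -
  from assms obtain bs cs where "\<forall>x. f x = (\<Sum>b\<leftarrow>bs. (quadratic_form b x)\<^sup>2)"
    "\<forall>x. g x = (\<Sum>b\<leftarrow>cs. (quadratic_form b x)\<^sup>2)"
    unfolding sum_of_squares_def by blast
  then show ?thesis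
    unfolding sum_of_squares_def by (intro exI [of _ "bs @ cs"]) simp
qed

lemma sum_of_squares_scale:
  assumes "sum_of_squares f" "0 \<le> c"
  shows "sum_of_squares (\<lambda>x. c * f x)"
proof -
  from assms obtain bs where bs: "\<forall>x. f x = (\<Sum>b\<leftarrow>bs. (quadratic_form b x)\<^sup>2)"
    unfolding sum_of_squares_def by blast
  have "c * f x = (\<Sum>b\<leftarrow>map (\<lambda>b. sqrt c *\<^sub>R b) bs. (quadratic_form b x)\<^sup>2)" for x
    using assms(2) bs
    by (simp add: quadratic_form_scaleR power_mult_distrib sum_list_const_mult o_def)
  then show ?thesis
    unfolding sum_of_squares_def by blast
qed

lemma sum_of_squares_square: "sum_of_squares (\<lambda>x. (quadratic_form b x)\<^sup>2)"
  unfolding sum_of_squares_def by (rule exI [of _ "[b]"]) simp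

text \<open>With sums and nonnegative multiples, these squares build every explicit certificate
  below.\<close>

lemma sum_of_squares_trinomial_square:
  "sum_of_squares (\<lambda>x. (a * (x $ i * x $ j) + b * (x $ k * x $ l) + c * (x $ m * x $ n))\<^sup>2)"
proof -
  let ?m = "\<lambda>i j. (\<chi> k l. if k = i \<and> l = j then 1 else 0) :: real^'n^'n"
  show ?thesis
    using sum_of_squares_square [of "a *\<^sub>R ?m i j + b *\<^sub>R ?m k l + c *\<^sub>R ?m m n"]
    by (simp only: quadratic_form_add quadratic_form_scaleR quadratic_form_single)
qed

lemma sum_of_squares_binomial_square:
  "sum_of_squares (\<lambda>x. (a * (x $ i * x $ j) + b * (x $ k * x $ l))\<^sup>2)"
  using sum_of_squares_trinomial_square [of a i j b k l 0] by simp

lemma sum_of_squares_sum: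
  "(\<And>i. i \<in> S \<Longrightarrow> sum_of_squares (f i)) \<Longrightarrow> sum_of_squares (\<lambda>x. \<Sum>i\<in>S. f i x)"
  by (induction S rule: infinite_finite_induct) (auto intro: sum_of_squares_0 sum_of_squares_add)

lemma sum_of_squares_fourth_powers:
  assumes "\<And>m. 0 \<le> r m"
  shows "sum_of_squares (\<lambda>x. \<Sum>m\<in>UNIV. r m * (x $ m) ^ 4)"
proof (rule sum_of_squares_sum)
  fix m
  show "sum_of_squares (\<lambda>x. r m * (x $ m) ^ 4)"
    using sum_of_squares_scale [OF sum_of_squares_binomial_square [of 1 m m 0] assms [of m]]
    by (simp add: power2_eq_square power4_eq_xxxx mult.assoc)
qed

lemma sum_of_squares_nonneg: "sum_of_squares f \<Longrightarrow> 0 \<le> f x"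
  unfolding sum_of_squares_def by (auto intro!: sum_list_nonneg)

text \<open>The form only sees the symmetric part of \<open>b\<close>. An antisymmetric part would
  be invisible in the values of \<open>f\<close> and could be arbitrarily large, ruling out norm
  bounds.\<close>

lemma sum_of_squares_symmetric:
  fixes f :: "real^'n \<Rightarrow> real"
  assumes "sum_of_squares f"
  obtains bs where "\<And>b. b \<in> set bs \<Longrightarrow> transpose b = b"
    "\<And>x. f x = (\<Sum>b\<leftarrow>bs. (quadratic_form b x)\<^sup>2)"
proof -
  obtain bs where bs: "\<And>x. f x = (\<Sum>b\<leftarrow>bs. (quadratic_form b x)\<^sup>2)"
    using assms unfolding sum_of_squares_def by blast
  let ?s = "\<lambda>b :: real^'n^'n. (1/2) *\<^sub>R (b + transpose b)"
  have "quadratic_form (?s b) x = quadratic_form b x" for b x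
    by (simp add: quadratic_form_add quadratic_form_scaleR quadratic_form_transpose del: scaleR_add_right)
  then have "f x = (\<Sum>b\<leftarrow>map ?s bs. (quadratic_form b x)\<^sup>2)" for x
    by (simp add: bs o_def del: scaleR_add_right)
  moreover have "transpose b = b" if "b \<in> set (map ?s bs)" for b
    using that by (auto simp: transpose_def vec_eq_iff)
  ultimately show ?thesis
    using that by blast
qed

section \<open>Gram tensors and closedness of the cone of sums of squares\<close>

definition tensor_square :: "real^'n^'n \<Rightarrow> real^'n^'n^'n^'n" where
  "tensor_square b = (\<chi> i j k l. b $ i $ j * b $ k $ l)"

definition quartic_form :: "real^'n^'n^'n^'n \<Rightarrow> real^'n \<Rightarrow> real" where
  "quartic_form G x = (\<Sum>i\<in>UNIV. \<Sum>j\<in>UNIV. \<Sum>k\<in>UNIV. \<Sum>l\<in>UNIV.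
     G $ i $ j $ k $ l * x $ i * x $ j * x $ k * x $ l)"

lemma quartic_form_add: "quartic_form (G + H) x = quartic_form G x + quartic_form H x"
  by (simp add: quartic_form_def sum.distrib algebra_simps)

lemma quartic_form_scaleR: "quartic_form (c *\<^sub>R G) x = c * quartic_form G x"
  by (simp add: quartic_form_def sum_distrib_left mult.assoc)

lemma continuous_on_quartic_form: "continuous_on S (\<lambda>G. quartic_form G x)"
  unfolding quartic_form_def by (intro continuous_intros)

text \<open>Squares become linear in the rank-one Gram tensor, so sums of squares can be studied by
  convexity.\<close>

lemma quartic_form_tensor_square: "quartic_form (tensor_square b) x = (quadratic_form b x)\<^sup>2"
proof -
  have "quartic_form (tensor_square b) x
      = (\<Sum>i\<in>UNIV. \<Sum>j\<in>UNIV. (b $ i $ j * x $ i * x $ j) * quadratic_form b x)"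
    unfolding quartic_form_def tensor_square_def quadratic_form_def sum_distrib_left
    by (simp add: mult_ac)
  then show ?thesis
    by (simp add: power2_eq_square quadratic_form_def sum_distrib_right)
qed

lemma tensor_square_scaleR: "tensor_square (c *\<^sub>R b) = c\<^sup>2 *\<^sub>R tensor_square b"
  by (simp add: tensor_square_def vec_eq_iff power2_eq_square mult_ac)

lemma compact_tensor_square_sphere: "compact (tensor_square ` sphere 0 1)"
  by (intro compact_continuous_image)
     (auto simp: tensor_square_def [abs_def] intro!: continuous_intros)

lemma sum_of_squares_hull:
  assumes "G \<in> convex hull (tensor_square ` S)"
  shows "sum_of_squares (quartic_form G)"
proof -
  have "convex {G. sum_of_squares (quartic_form G)}"
  proof (rule convexI)
    fix G H :: "real^'n^'n^'n^'n" and u v :: real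
    assume "G \<in> {G. sum_of_squares (quartic_form G)}" "H \<in> {G. sum_of_squares (quartic_form G)}"
      "0 \<le> u" "0 \<le> v"
    then have "sum_of_squares (\<lambda>x. u * quartic_form G x + v * quartic_form H x)"
      by (intro sum_of_squares_add sum_of_squares_scale) auto
    then show "u *\<^sub>R G + v *\<^sub>R H \<in> {G. sum_of_squares (quartic_form G)}"
      by (simp add: quartic_form_add [abs_def] quartic_form_scaleR [abs_def])
  qed
  moreover have "sum_of_squares (quartic_form (tensor_square b))" for b :: "real^'n^'n"
    using sum_of_squares_square [of b] by (simp add: quartic_form_tensor_square [abs_def])
  ultimately have "convex hull (tensor_square ` S) \<subseteq> {G. sum_of_squares (quartic_form G)}"
    by (intro hull_minimal) auto
  then show ?thesis
    using assms by blast
qed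

text \<open>Normalizing each nonzero \<open>b\<close> to the unit sphere turns the sum into its
  total weight times a convex combination. With total weight 0, any point of the hull
  serves.\<close>

lemma sum_list_tensor_square_in_hull:
  fixes bs :: "(real^'n^'n) list"
  shows "\<exists>G \<in> convex hull (tensor_square ` sphere 0 1).
    (\<Sum>b\<leftarrow>bs. tensor_square b) = (\<Sum>b\<leftarrow>bs. (norm b)\<^sup>2) *\<^sub>R G"
proof (induction bs)
  case Nil
  have "sphere (0 :: real^'n^'n) 1 \<noteq> {}"
    by simp
  then obtain b :: "real^'n^'n" where "b \<in> sphere 0 1"
    by blast
  then show ?case
    by (intro bexI [of _ "tensor_square b"] hull_inc imageI) auto
next
  case (Cons b bs)
  let ?C = "convex hull (tensor_square ` sphere (0 :: real^'n^'n) 1)"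
  let ?t = "\<Sum>b\<leftarrow>bs. (norm b)\<^sup>2"
  obtain G where G: "G \<in> ?C" "(\<Sum>b\<leftarrow>bs. tensor_square b) = ?t *\<^sub>R G"
    using Cons.IH by blast
  have t: "0 \<le> ?t"
    by (rule sum_list_nonneg) auto
  show ?case
  proof (cases "b = 0")
    case True
    then have "tensor_square b = 0"
      using tensor_square_scaleR [of 0 b] by simp
    then show ?thesis
      using G True by auto
  next
    case False
    then have b: "sgn b \<in> sphere 0 1" "b = norm b *\<^sub>R sgn b"
      by (simp_all add: norm_sgn sgn_div_norm)
    define s where "s = (norm b)\<^sup>2 + ?t"
    have s: "0 < s"
      using False t by (simp add: s_def add_pos_nonneg)
    have "tensor_square b + ?t *\<^sub>R G
        = s *\<^sub>R (((norm b)\<^sup>2 / s) *\<^sub>R tensor_square (sgn b) + (?t / s) *\<^sub>R G)"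
      using s tensor_square_scaleR [of "norm b" "sgn b"] b(2) by (simp add: scaleR_add_right)
    moreover have "((norm b)\<^sup>2 / s) *\<^sub>R tensor_square (sgn b) + (?t / s) *\<^sub>R G \<in> ?C"
      using G(1) b(1) s t
      by (intro convexD [OF convex_convex_hull])
         (auto intro: hull_inc simp: s_def simp flip: add_divide_distrib)
    ultimately show ?thesis
      using G(2) by (auto simp: s_def)
  qed
qed

text \<open>Each squared entry is bounded via \<open>polarization\<close> by values of the squares,
  which add up to values of \<open>f\<close>. The bound is thus independent of the number of
  squares.\<close>

lemma sum_norm_le_polarization:
  assumes "\<And>b. b \<in> set bs \<Longrightarrow> transpose b = b" "\<And>x. f x = (\<Sum>b\<leftarrow>bs. (quadratic_form b x)\<^sup>2)"
  shows "(\<Sum>b\<leftarrow>bs. (norm b)\<^sup>2) \<le>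
    (\<Sum>i\<in>UNIV. \<Sum>j\<in>UNIV. (f (axis i 1 + axis j 1) + f (axis i 1 - axis j 1)) / 8)"
proof -
  let ?q = quadratic_form
  let ?r = "\<lambda>b. \<Sum>i\<in>UNIV. \<Sum>j\<in>UNIV.
    ((?q b (axis i 1 + axis j 1))\<^sup>2 + (?q b (axis i 1 - axis j 1))\<^sup>2) / 8"
  have "(norm b)\<^sup>2 \<le> ?r b" if "b \<in> set bs" for b
  proof -
    have le: "((y - z) / 4)\<^sup>2 \<le> (y\<^sup>2 + z\<^sup>2) / 8" for y z :: real
      using zero_le_power2 [of "y + z"] by (simp add: power2_eq_square field_simps)
    have "(norm b)\<^sup>2 = (\<Sum>i\<in>UNIV. \<Sum>j\<in>UNIV. (b $ i $ j)\<^sup>2)"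
      by (simp add: norm_vec_def L2_set_def sum_nonneg)
    also have "\<dots> \<le> ?r b"
      by (intro sum_mono) (metis polarization assms(1) that le)
    finally show ?thesis .
  qed
  then have "(\<Sum>b\<leftarrow>bs. (norm b)\<^sup>2) \<le> (\<Sum>b\<leftarrow>bs. ?r b)"
    by (rule sum_list_mono)
  also have "\<dots> = (\<Sum>i\<in>UNIV. \<Sum>j\<in>UNIV. (f (axis i 1 + axis j 1) + f (axis i 1 - axis j 1)) / 8)"
    unfolding assms(2)
    by (induction bs) (simp_all add: sum.distrib add_divide_distrib algebra_simps)
  finally show ?thesis .
qed

lemma quartic_form_sum_list: "quartic_form (\<Sum>b\<leftarrow>bs. h b) x = (\<Sum>b\<leftarrow>bs. quartic_form (h b) x)"
proof (induction bs)
  case Nil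
  then show ?case by (simp add: quartic_form_def)
qed (simp add: quartic_form_add)

text \<open>The Gram tensors of the given sums of squares stay in a compact set: their traces are
  controlled by finitely many values of the forms.\<close>

lemma sum_of_squares_limit:
  fixes f :: "nat \<Rightarrow> real^'n \<Rightarrow> real"
  assumes sos: "\<And>n. sum_of_squares (f n)" and lim: "\<And>x. (\<lambda>n. f n x) \<longlonglongrightarrow> g x"
  shows "sum_of_squares g"
proof -
  let ?C = "convex hull (tensor_square ` sphere (0 :: real^'n^'n) 1)"
  let ?T = "\<lambda>f. \<Sum>i\<in>UNIV. \<Sum>j\<in>UNIV. (f (axis i 1 + axis j 1) + f (axis i 1 - axis j (1::real))) / 8"
  have "(\<lambda>n. ?T (f n)) \<longlonglongrightarrow> ?T g"
    by (intro tendsto_intros lim) simp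
  then have "Bseq (\<lambda>n. ?T (f n))"
    by (rule convergent_imp_Bseq [OF convergentI])
  then obtain T where "\<forall>n. norm (?T (f n)) \<le> T"
    by (rule BseqE)
  then have T: "?T (f n) \<le> T" for n
    by (rule allE [of _ n]) (simp only: real_norm_def abs_le_iff)
  \<comment> \<open>A decomposition of any length is encoded as a point of one fixed compact set: a
    weight and a Gram tensor in the hull.\<close>
  have "\<exists>p. p \<in> {0..T} \<times> ?C \<and> (\<forall>x. f n x = fst p * quartic_form (snd p) x)" for n
  proof -
    obtain bs where bs: "\<And>b. b \<in> set bs \<Longrightarrow> transpose b = b"
        "\<And>x. f n x = (\<Sum>b\<leftarrow>bs. (quadratic_form b x)\<^sup>2)"
      using sum_of_squares_symmetric [OF sos [of n]] by blast
    let ?t = "\<Sum>b\<leftarrow>bs. (norm b)\<^sup>2"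
    obtain G where G: "G \<in> ?C" "(\<Sum>b\<leftarrow>bs. tensor_square b) = ?t *\<^sub>R G"
      using sum_list_tensor_square_in_hull by blast
    have "?t \<le> T"
      using sum_norm_le_polarization [OF bs] T [of n] by linarith
    moreover have "0 \<le> ?t"
      by (rule sum_list_nonneg) auto
    moreover have "f n x = ?t * quartic_form G x" for x
      by (metis (no_types, lifting) bs(2) G(2) quartic_form_scaleR quartic_form_sum_list
          quartic_form_tensor_square map_eq_conv)
    ultimately show ?thesis
      using G(1) by (intro exI [of _ "(?t, G)"]) auto
  qed
  then obtain p where p: "\<And>n. p n \<in> {0..T} \<times> ?C" "\<And>n x. f n x = fst (p n) * quartic_form (snd (p n)) x"
    by metis
  have "compact ({0..T} \<times> ?C)"
    by (intro compact_Times compact_convex_hull compact_tensor_square_sphere) simp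
  then obtain q r where q: "q \<in> {0..T} \<times> ?C" "strict_mono r" "(p \<circ> r) \<longlonglongrightarrow> q"
    using p(1) unfolding compact_def by meson
  have "g x = fst q * quartic_form (snd q) x" for x
  proof -
    have "continuous_on UNIV (\<lambda>q. fst q * quartic_form (snd q) x)"
      by (intro continuous_intros continuous_on_compose2 [OF continuous_on_quartic_form [of UNIV]]) auto
    then have "(\<lambda>n. fst ((p \<circ> r) n) * quartic_form (snd ((p \<circ> r) n)) x) \<longlonglongrightarrow> fst q * quartic_form (snd q) x"
      using continuous_on_tendsto_compose [OF _ q(3)] by fastforce
    then have "((\<lambda>n. f n x) \<circ> r) \<longlonglongrightarrow> fst q * quartic_form (snd q) x"
      by (simp add: o_def p(2))
    then show ?thesis
      using LIMSEQ_subseq_LIMSEQ [OF lim q(2)] LIMSEQ_unique by blast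
  qed
  moreover have "sum_of_squares (\<lambda>x. fst q * quartic_form (snd q) x)"
    using q(1) sum_of_squares_scale [OF sum_of_squares_hull [of "snd q" "sphere 0 1"], of "fst q"]
    by (simp add: mem_Times_iff)
  ultimately show ?thesis
    by (simp add: sum_of_squares_def)
qed


section \<open>Hankel tensors\<close>

lemma sum_upto_4: "(\<Sum>i=1..4. f (i::nat)) = f 1 + f 2 + f 3 + (f 4 :: real)"
  by (simp add: numeral_eq_Suc add.assoc)

text \<open>The factor of \<open>v ! m\<close> collects the monomials whose indices, counted from 0,
  add up to \<open>m\<close>, with their multinomial coefficients.\<close>

lemma tensor_poly_hankel:
  "tensor_poly (hankel_tensor v) x = (let a = x $ 1; b = x $ 2; c = x $ 3; d = x $ 4 in
     v ! 0 * a^4 + 4 * v ! 1 * (a^3 * b) + v ! 2 * (4 * (a^3 * c) + 6 * (a^2 * b^2))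
   + v ! 3 * (4 * (a^3 * d) + 12 * (a^2 * b * c) + 4 * (a * b^3))
   + v ! 4 * (12 * (a^2 * b * d) + 6 * (a^2 * c^2) + 12 * (a * b^2 * c) + b^4)
   + v ! 5 * (12 * (a^2 * c * d) + 12 * (a * b^2 * d) + 12 * (a * b * c^2) + 4 * (b^3 * c))
   + v ! 6 * (6 * (a^2 * d^2) + 24 * (a * b * c * d) + 4 * (a * c^3) + 4 * (b^3 * d) + 6 * (b^2 * c^2))
   + v ! 7 * (12 * (a * b * d^2) + 12 * (a * c^2 * d) + 12 * (b^2 * c * d) + 4 * (b * c^3))
   + v ! 8 * (12 * (a * c * d^2) + 6 * (b^2 * d^2) + 12 * (b * c^2 * d) + c^4)
   + v ! 9 * (4 * (a * d^3) + 12 * (b * c * d^2) + 4 * (c^3 * d))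
   + v ! 10 * (4 * (b * d^3) + 6 * (c^2 * d^2)) + 4 * v ! 11 * (c * d^3) + v ! 12 * d^4)"
  unfolding tensor_poly_def hankel_tensor_def sum_upto_4 Let_def
  by (simp, simp add: algebra_simps power2_eq_square power3_eq_cube power4_eq_xxxx numeral_2_eq_2 numeral_3_eq_3)

lemma sum_of_nat_4: "(\<Sum>i = 1..4. h (of_nat i :: 4)) = (\<Sum>i\<in>UNIV. h i)"
  by (rule sum.reindex_bij_betw [OF bij_betw_of_nat_4])

lemma homogeneous_quadratic_iff: "homogeneous_quadratic q \<longleftrightarrow> (\<exists>b. q = quadratic_form b)"
proof
  assume "homogeneous_quadratic q"
  then obtain b :: "nat \<Rightarrow> nat \<Rightarrow> real"
    where b: "\<And>x. q x = (\<Sum>i = 1..4. \<Sum>j = 1..4. b i j * x $ of_nat i * x $ of_nat j)"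
    unfolding homogeneous_quadratic_def by blast
  let ?g = "the_inv_into {1..4} (of_nat :: nat \<Rightarrow> 4)"
  have g: "?g (of_nat i) = i" if "i \<in> {1..4}" for i
    using that bij_betw_of_nat_4 by (intro the_inv_into_f_f) (auto simp: bij_betw_def)
  have "q x = quadratic_form (\<chi> i j. b (?g i) (?g j)) x" for x
    unfolding b quadratic_form_def sum_of_nat_4 [symmetric] vec_lambda_beta
    by (intro sum.cong refl) (simp only: g)
  then show "\<exists>b. q = quadratic_form b"
    by blast
next
  assume "\<exists>b. q = quadratic_form b"
  then obtain b where "q = quadratic_form b" ..
  then show "homogeneous_quadratic q"
    unfolding homogeneous_quadratic_def quadratic_form_def
    by (intro exI [of _ "\<lambda>i j. b $ of_nat i $ of_nat j"]) (simp flip: sum_of_nat_4)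
qed

lemma SOS_iff: "SOS A \<longleftrightarrow> sum_of_squares (tensor_poly A)"
proof -
  have "SOS A \<longleftrightarrow> (\<exists>qs. (\<exists>bs. qs = map quadratic_form bs) \<and> (\<forall>x. tensor_poly A x = (\<Sum>q\<leftarrow>qs. (q x)\<^sup>2)))"
    unfolding SOS_def homogeneous_quadratic_iff ex_map_conv ..
  also have "\<dots> \<longleftrightarrow> sum_of_squares (tensor_poly A)"
    by (auto simp: sum_of_squares_def o_def)
  finally show ?thesis .
qed

lemma SOS_imp_PSD: "SOS A \<Longrightarrow> PSD A"
  by (simp add: SOS_iff PSD_def sum_of_squares_nonneg)

text \<open>Absorbable forms can be turned into sums of squares by raising \<open>v\<^sub>0\<close>, at an arbitrarily
  small cost in the middle variables.\<close>

definition absorbable :: "(real^4 \<Rightarrow> real) \<Rightarrow> bool" where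
  "absorbable h \<longleftrightarrow> (\<forall>\<epsilon>>0. \<exists>C. sum_of_squares
     (\<lambda>x. C * ((x $ 1) ^ 4 + (x $ 4) ^ 4) + \<epsilon> * ((x $ 2) ^ 4 + (x $ 3) ^ 4) + h x))"

lemma absorbable_add:
  assumes "absorbable g" "absorbable h"
  shows "absorbable (\<lambda>x. g x + h x)"
  unfolding absorbable_def
proof (intro allI impI)
  fix \<epsilon> :: real
  assume "\<epsilon> > 0"
  then have "\<epsilon> / 2 > 0"
    by simp
  then obtain C D where
    "sum_of_squares (\<lambda>x. C * ((x $ 1) ^ 4 + (x $ 4) ^ 4) + \<epsilon> / 2 * ((x $ 2) ^ 4 + (x $ 3) ^ 4) + g x)"
    "sum_of_squares (\<lambda>x. D * ((x $ 1) ^ 4 + (x $ 4) ^ 4) + \<epsilon> / 2 * ((x $ 2) ^ 4 + (x $ 3) ^ 4) + h x)"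
    using assms unfolding absorbable_def by meson
  from sum_of_squares_add [OF this]
  have "sum_of_squares (\<lambda>x. (C + D) * ((x $ 1) ^ 4 + (x $ 4) ^ 4) + \<epsilon> * ((x $ 2) ^ 4 + (x $ 3) ^ 4) + (g x + h x))"
    by (rule arg_cong [of _ _ sum_of_squares, THEN iffD1, rotated]) (auto simp: fun_eq_iff field_simps)
  then show "\<exists>C. sum_of_squares (\<lambda>x. C * ((x $ 1) ^ 4 + (x $ 4) ^ 4) + \<epsilon> * ((x $ 2) ^ 4 + (x $ 3) ^ 4) + (g x + h x))"
    by blast
qed

text \<open>Three applications of AM-GM, written as squares: the monomial costs
  \<open>K * (x $ i * x $ j)\<^sup>2\<close> and \<open>\<delta> * (x $ k * x $ l)\<^sup>2\<close>;
  the former costs \<open>A\<close> at \<open>x $ i\<close> and \<open>\<delta>\<close> at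
  \<open>x $ j\<close>, the latter \<open>\<delta> / 2\<close> each at \<open>x $ k\<close> and
  \<open>x $ l\<close>. Only the outer variable \<open>x $ i\<close> gets a large
  coefficient.\<close>

lemma absorbable_monomial:
  assumes i: "i = 1 \<or> i = 4"
  shows "absorbable (\<lambda>x. c * (x $ i * x $ j * x $ k * x $ l))"
  unfolding absorbable_def
proof (intro allI impI)
  fix \<epsilon> :: real
  assume \<epsilon>: "\<epsilon> > 0"
  \<comment> \<open>The costs at \<open>j\<close>, \<open>k\<close>, \<open>l\<close> total
    \<open>2 * \<delta> = \<epsilon>\<close>, which suffices even if these indices coincide.
    \<open>K\<close> and \<open>A\<close> come from completing the squares.\<close>
  define \<delta> where "\<delta> = \<epsilon> / 2"
  define K where "K = c\<^sup>2 / (4 * \<delta>)"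
  define A where "A = K\<^sup>2 / (4 * \<delta>)"
  define s where "s = sqrt \<delta>"
  have s: "s > 0" "s * s = \<delta>"
    using \<epsilon> by (simp_all add: s_def \<delta>_def)
  then have \<delta>: "\<delta> > 0" "A \<ge> 0"
    by (auto simp: A_def)
  \<comment> \<open>What remains of each fourth power once the three squares are paid for, with
    \<open>A + \<epsilon>\<close> as the constant \<open>C\<close>.\<close>
  define r :: "4 \<Rightarrow> real" where "r m = (if m = 1 \<or> m = 4 then A + \<epsilon> else \<epsilon>)
    - (if m = i then A else 0) - (if m = j then \<delta> else 0)
    - (if m = k then \<delta> / 2 else 0) - (if m = l then \<delta> / 2 else 0)" for m
  have "r m \<ge> 0" for m
  proof -
    have "\<epsilon> \<le> (if m = 1 \<or> m = 4 then A + \<epsilon> else \<epsilon>) - (if m = i then A else 0)"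
      using i \<delta>(2) by (cases "m = i") simp_all
    moreover have "(if m = n then b else 0) \<le> b" if "0 \<le> b" for n and b :: real
      using that by simp
    from this [of \<delta> j] this [of "\<delta> / 2" k] this [of "\<delta> / 2" l]
    have "(if m = j then \<delta> else 0) + (if m = k then \<delta> / 2 else 0) + (if m = l then \<delta> / 2 else 0) \<le> \<epsilon>"
      using \<delta>(1) \<delta>_def by linarith
    ultimately show ?thesis
      unfolding r_def by linarith
  qed
  then have r: "sum_of_squares (\<lambda>x. \<Sum>m\<in>UNIV. r m * (x $ m) ^ 4)"
    by (rule sum_of_squares_fourth_powers)
  have r_sum: "(\<Sum>m\<in>UNIV. r m * (x $ m) ^ 4) =
      (A + \<epsilon>) * ((x $ 1) ^ 4 + (x $ 4) ^ 4) + \<epsilon> * ((x $ 2) ^ 4 + (x $ 3) ^ 4)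
      - A * (x $ i) ^ 4 - \<delta> * (x $ j) ^ 4 - \<delta> / 2 * (x $ k) ^ 4 - \<delta> / 2 * (x $ l) ^ 4" for x :: "real^4"
  proof -
    have delta: "(\<Sum>m\<in>UNIV. (if m = n then b else 0) * (x $ m) ^ 4) = b * (x $ n) ^ 4" for n b
      by (simp add: if_distrib [of "\<lambda>c. c * _"] cong: if_cong)
    have main: "(\<Sum>m\<in>UNIV. (if m = 1 \<or> m = 4 then A + \<epsilon> else \<epsilon>) * (x $ m) ^ 4)
        = (A + \<epsilon>) * ((x $ 1) ^ 4 + (x $ 4) ^ 4) + \<epsilon> * ((x $ 2) ^ 4 + (x $ 3) ^ 4)"
      by (simp add: sum_4 algebra_simps)
    show ?thesis
      unfolding r_def left_diff_distrib sum_subtractf delta main ..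
  qed
  have "sum_of_squares (\<lambda>x. (c / (2 * s) * (x $ i * x $ j) + s * (x $ k * x $ l))\<^sup>2
      + (K / (2 * s) * (x $ i * x $ i) + (- s) * (x $ j * x $ j))\<^sup>2
      + \<delta> / 2 * (1 * (x $ k * x $ k) + (- 1) * (x $ l * x $ l))\<^sup>2
      + (\<Sum>m\<in>UNIV. r m * (x $ m) ^ 4))"
    using \<delta>(1) by (intro sum_of_squares_add sum_of_squares_scale sum_of_squares_binomial_square r) simp
  also have "(\<lambda>x. (c / (2 * s) * (x $ i * x $ j) + s * (x $ k * x $ l))\<^sup>2
      + (K / (2 * s) * (x $ i * x $ i) + (- s) * (x $ j * x $ j))\<^sup>2
      + \<delta> / 2 * (1 * (x $ k * x $ k) + (- 1) * (x $ l * x $ l))\<^sup>2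
      + (\<Sum>m\<in>UNIV. r m * (x $ m) ^ 4))
    = (\<lambda>x. (A + \<epsilon>) * ((x $ 1) ^ 4 + (x $ 4) ^ 4) + \<epsilon> * ((x $ 2) ^ 4 + (x $ 3) ^ 4)
      + c * (x $ i * x $ j * x $ k * x $ l))"
  proof
    fix x :: "real^4"
    have sq: "(b / (2 * s) * y + s * z)\<^sup>2 = b\<^sup>2 / (4 * \<delta>) * y\<^sup>2 + b * (y * z) + \<delta> * z\<^sup>2" for b y z
      using s(1) unfolding s(2) [symmetric] by (simp add: power2_eq_square field_simps)
    have 1: "(c / (2 * s) * (x $ i * x $ j) + s * (x $ k * x $ l))\<^sup>2
        = K * (x $ i * x $ j)\<^sup>2 + c * ((x $ i * x $ j) * (x $ k * x $ l)) + \<delta> * (x $ k * x $ l)\<^sup>2"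
      unfolding sq K_def ..
    have 2: "(K / (2 * s) * (x $ i * x $ i) + (- s) * (x $ j * x $ j))\<^sup>2
        = A * (x $ i * x $ i)\<^sup>2 - K * ((x $ i * x $ i) * (x $ j * x $ j)) + \<delta> * (x $ j * x $ j)\<^sup>2"
      using sq [of K "x $ i * x $ i" "- (x $ j * x $ j)"] by (simp add: A_def)
    show "(c / (2 * s) * (x $ i * x $ j) + s * (x $ k * x $ l))\<^sup>2
      + (K / (2 * s) * (x $ i * x $ i) + (- s) * (x $ j * x $ j))\<^sup>2
      + \<delta> / 2 * (1 * (x $ k * x $ k) + (- 1) * (x $ l * x $ l))\<^sup>2
      + (\<Sum>m\<in>UNIV. r m * (x $ m) ^ 4)
      = (A + \<epsilon>) * ((x $ 1) ^ 4 + (x $ 4) ^ 4) + \<epsilon> * ((x $ 2) ^ 4 + (x $ 3) ^ 4)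
      + c * (x $ i * x $ j * x $ k * x $ l)"
      unfolding 1 2 r_sum by (simp add: power2_eq_square power4_eq_xxxx algebra_simps)
  qed
  finally show "\<exists>C. sum_of_squares (\<lambda>x. C * ((x $ 1) ^ 4 + (x $ 4) ^ 4)
      + \<epsilon> * ((x $ 2) ^ 4 + (x $ 3) ^ 4) + c * (x $ i * x $ j * x $ k * x $ l))"
    by blast
qed

section \<open>The binary quartic left when the first and last variables vanish\<close>

definition binary_quartic :: "real \<Rightarrow> real \<Rightarrow> real \<Rightarrow> real \<Rightarrow> real" where
  "binary_quartic \<beta> \<gamma> s t = s ^ 4 + 4 * \<beta> * (s ^ 3 * t) + 6 * \<gamma> * (s\<^sup>2 * t\<^sup>2) + 4 * \<beta> * (s * t ^ 3) + t ^ 4"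

text \<open>With \<open>S = s\<^sup>2 + t\<^sup>2\<close> and \<open>T = s t\<close>, the binary quartic is
  \<open>\<mu> (S\<^sup>2 - 4 T\<^sup>2) + (1 - \<mu>) S\<^sup>2 + 4 \<beta> S T + (6 \<gamma> - 2 + 4 \<mu>) T\<^sup>2\<close>, where \<open>S\<^sup>2 - 4 T\<^sup>2 = (s\<^sup>2 - t\<^sup>2)\<^sup>2\<close>.
  So \<open>\<mu>\<close> has to make the quadratic form in \<open>S\<close>, \<open>T\<close> positive definite; the choice
  below maximizes its determinant.\<close>

lemma eta_less_1_imp:
  assumes "eta \<beta> \<gamma> < 1"
  obtains \<mu> where "0 \<le> \<mu>" "\<mu> < 1" "4 * \<beta>\<^sup>2 < (1 - \<mu>) * (6 * \<gamma> - 2 + 4 * \<mu>)"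
proof (cases "\<gamma> \<le> 1")
  case True
  \<comment> \<open>The first branch of \<open>eta\<close> says exactly this; in the second it comes
    from \<open>\<bar>\<beta>\<bar> < \<gamma>\<close> and \<open>\<gamma> \<le> 1\<close>.\<close>
  have "4 * \<bar>\<beta>\<bar> < 1 + 3 * \<gamma>"
    using assms True by (auto simp: eta_def split: if_splits)
  moreover from this have "(4 * \<bar>\<beta>\<bar>)\<^sup>2 < (1 + 3 * \<gamma>)\<^sup>2"
    by (intro power_strict_mono) auto
  ultimately show ?thesis
    \<comment> \<open>At this maximizer the two factors are \<open>(1 + 3 * \<gamma>) / 4\<close>
      and \<open>1 + 3 * \<gamma>\<close>.\<close>
    using True by (intro that [of "3 / 4 * (1 - \<gamma>)"]) (auto simp: power2_eq_square field_simps)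
next
  case False
  \<comment> \<open>In the first branch \<open>eta\<close> would be at least
    \<open>\<gamma>\<close>, hence above 1.\<close>
  have \<beta>: "\<gamma> > \<bar>\<beta>\<bar>"
    using assms False by (auto simp: eta_def split: if_splits)
  then have "3 * \<gamma> - 2 < sqrt (9 * \<gamma>\<^sup>2 - 8 * \<beta>\<^sup>2)"
    using assms by (simp add: eta_def)
  then have "(3 * \<gamma> - 2)\<^sup>2 < 9 * \<gamma>\<^sup>2 - 8 * \<beta>\<^sup>2"
    using False by (smt (verit) real_less_rsqrt real_le_lsqrt sqrt_le_D)
  then show ?thesis
    \<comment> \<open>The unconstrained maximizer is negative here, so the boundary value 0 is
      taken.\<close>
    by (intro that [of 0]) (auto simp: power2_eq_square algebra_simps)
qed

text \<open>Positivity is tested at critical ratios: \<open>s = t\<close> and \<open>s = - t\<close>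
  settle the first branch of \<open>eta\<close>. In the second, a real ratio with
  \<open>s\<^sup>2 + t\<^sup>2 = - 2 * \<beta> * s * t\<close> exists if
  \<open>\<bar>\<beta>\<bar> \<ge> 1\<close>, and smaller \<open>\<bar>\<beta>\<bar>\<close> is
  elementary.\<close>

lemma eta_less_1I:
  assumes pos: "\<And>s t. (s, t) \<noteq> (0, 0) \<Longrightarrow> binary_quartic \<beta> \<gamma> s t > 0"
  shows "eta \<beta> \<gamma> < 1"
proof -
  have 1: "4 * \<bar>\<beta>\<bar> - 3 * \<gamma> < 1"
    using pos [of 1 1] pos [of 1 "-1"] by (simp add: binary_quartic_def abs_if)
  show ?thesis
  proof (cases "\<gamma> \<le> \<bar>\<beta>\<bar>")
    case True
    then show ?thesis
      using 1 by (simp add: eta_def)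
  next
    case False
    have "3 * \<gamma> - 2 < sqrt (9 * \<gamma>\<^sup>2 - 8 * \<beta>\<^sup>2)"
    proof (cases "3 * \<gamma> - 2 < 0")
      case True
      have "\<beta>\<^sup>2 \<le> \<gamma>\<^sup>2"
        using False by (simp add: abs_le_square_iff [symmetric])
      then show ?thesis
        using True by (smt (verit) real_sqrt_ge_zero zero_le_power2)
    next
      case large: False
      \<comment> \<open>This is the desired square root bound after squaring, as
        \<open>3 * \<gamma> - 2\<close> is nonnegative.\<close>
      have "2 * \<beta>\<^sup>2 < 3 * \<gamma> - 1"
      proof (cases "\<bar>\<beta>\<bar> < 1")
        case True
        show ?thesis
        proof (cases "\<bar>\<beta>\<bar> < 1 / 2")
          case True
          then have "\<bar>\<beta>\<bar>\<^sup>2 < (1 / 2)\<^sup>2"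
            by (intro power_strict_mono) auto
          then show ?thesis
            using large by (simp add: power2_eq_square)
        next
          case False
          \<comment> \<open>It expands to
            \<open>2 * \<beta>\<^sup>2 \<le> 3 * \<bar>\<beta>\<bar> - 1\<close>, to be combined
            with \<open>\<bar>\<beta>\<bar> < \<gamma>\<close>.\<close>
          then have "(2 * \<bar>\<beta>\<bar> - 1) * (\<bar>\<beta>\<bar> - 1) \<le> 0"
            using True by (intro mult_nonneg_nonpos) auto
          then show ?thesis
            using \<open>\<not> \<gamma> \<le> \<bar>\<beta>\<bar>\<close> by (simp add: power2_eq_square algebra_simps)
        qed
      next
        case False
        \<comment> \<open>A root of \<open>r\<^sup>2 + 2 * \<beta> * r + 1\<close>; there the
          quartic, as a quadratic in \<open>S = r\<^sup>2 + 1\<close> for fixed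
          \<open>T = r\<close>, is minimal.\<close>
        define r where "r = sqrt (\<beta>\<^sup>2 - 1) - \<beta>"
        have "\<beta>\<^sup>2 \<ge> 1"
          using False power_mono [of 1 "\<bar>\<beta>\<bar>" 2] by simp
        then have "(r + \<beta>)\<^sup>2 = \<beta>\<^sup>2 - 1"
          by (simp add: r_def)
        then have r: "r\<^sup>2 = - 1 - 2 * \<beta> * r"
          by (simp add: power2_eq_square algebra_simps)
        have "binary_quartic \<beta> \<gamma> r 1 = (r\<^sup>2 + 1)\<^sup>2 + 4 * \<beta> * r * (r\<^sup>2 + 1) + (6 * \<gamma> - 2) * r\<^sup>2"
          by (simp add: binary_quartic_def power2_eq_square power3_eq_cube power4_eq_xxxx algebra_simps)
        also have "r\<^sup>2 + 1 = - 2 * \<beta> * r"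
          using r by simp
        also have "(- 2 * \<beta> * r)\<^sup>2 + 4 * \<beta> * r * (- 2 * \<beta> * r) + (6 * \<gamma> - 2) * r\<^sup>2
            = (6 * \<gamma> - 2 - 4 * \<beta>\<^sup>2) * r\<^sup>2"
          by (simp add: power2_eq_square algebra_simps)
        finally have "(6 * \<gamma> - 2 - 4 * \<beta>\<^sup>2) * r\<^sup>2 > 0"
          using pos [of r 1] by simp
        then have "6 * \<gamma> - 2 - 4 * \<beta>\<^sup>2 > 0"
          by (simp add: zero_less_mult_iff)
        then show ?thesis
          by simp
      qed
      then have "(3 * \<gamma> - 2)\<^sup>2 < 9 * \<gamma>\<^sup>2 - 8 * \<beta>\<^sup>2"
        by (simp add: power2_eq_square algebra_simps)
      then show ?thesis
        by (rule real_less_rsqrt)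
    qed
    then show ?thesis
      using False by (simp add: eta_def)
  qed
qed

text \<open>Completing the square in \<open>S\<close> and \<open>T\<close> leaves
  \<open>\<epsilon> * S\<^sup>2\<close>, and \<open>S\<^sup>2 - 2 * T\<^sup>2 = s^4 + t^4\<close>
  turns this into the slack needed to absorb mixed monomials.\<close>

lemma binary_quartic_sum_of_squares:
  assumes "eta \<beta> \<gamma> < 1"
  obtains \<epsilon> where "\<epsilon> > 0"
    "sum_of_squares (\<lambda>x :: real^'n. binary_quartic \<beta> \<gamma> (x $ i) (x $ j) - \<epsilon> * ((x $ i) ^ 4 + (x $ j) ^ 4))"
proof -
  obtain \<mu> where \<mu>: "0 \<le> \<mu>" "\<mu> < 1" "4 * \<beta>\<^sup>2 < (1 - \<mu>) * (6 * \<gamma> - 2 + 4 * \<mu>)"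
    using eta_less_1_imp [OF assms] .
  define r where "r = 6 * \<gamma> - 2 + 4 * \<mu>"
  define q where "q = sqrt r"
  have "0 < (1 - \<mu>) * r"
    using \<mu>(3) zero_le_power2 [of \<beta>] unfolding r_def by linarith
  then have r: "r > 0"
    using \<mu>(2) by (simp add: zero_less_mult_iff)
  then have q: "q > 0" "q * q = r"
    by (simp_all add: q_def)
  \<comment> \<open>The Schur complement: the coefficient of \<open>S\<^sup>2\<close> left after
    completing the square, positive by the determinant condition on \<open>\<mu>\<close>.\<close>
  define \<epsilon> where "\<epsilon> = 1 - \<mu> - 4 * \<beta>\<^sup>2 / r"
  have \<epsilon>: "\<epsilon> > 0"
    using \<mu>(3) r by (simp add: \<epsilon>_def r_def [symmetric] pos_divide_less_eq)
  have "sum_of_squares (\<lambda>x :: real^'n. \<mu> * (1 * (x $ i * x $ i) + (- 1) * (x $ j * x $ j))\<^sup>2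
      + (2 * \<beta> / q * (x $ i * x $ i) + 2 * \<beta> / q * (x $ j * x $ j) + q * (x $ i * x $ j))\<^sup>2
      + 2 * \<epsilon> * (1 * (x $ i * x $ j) + 0 * (x $ i * x $ j))\<^sup>2)"
    using \<mu>(1) \<epsilon> by (intro sum_of_squares_add sum_of_squares_scale sum_of_squares_binomial_square
        sum_of_squares_trinomial_square) auto
  also have "(\<lambda>x :: real^'n. \<mu> * (1 * (x $ i * x $ i) + (- 1) * (x $ j * x $ j))\<^sup>2
      + (2 * \<beta> / q * (x $ i * x $ i) + 2 * \<beta> / q * (x $ j * x $ j) + q * (x $ i * x $ j))\<^sup>2
      + 2 * \<epsilon> * (1 * (x $ i * x $ j) + 0 * (x $ i * x $ j))\<^sup>2)
    = (\<lambda>x. binary_quartic \<beta> \<gamma> (x $ i) (x $ j) - \<epsilon> * ((x $ i) ^ 4 + (x $ j) ^ 4))"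
  proof
    fix x :: "real^'n"
    define s t where "s = x $ i" and "t = x $ j"
    have sq: "(2 * \<beta> / q * (s * s) + 2 * \<beta> / q * (t * t) + q * (s * t))\<^sup>2
        = (1 - \<mu> - \<epsilon>) * (s * s + t * t)\<^sup>2 + 4 * \<beta> * ((s * s + t * t) * (s * t)) + r * (s * t)\<^sup>2"
      using q(1) unfolding \<epsilon>_def q(2) [symmetric] by (simp add: power2_eq_square field_simps)
    show "\<mu> * (1 * (x $ i * x $ i) + (- 1) * (x $ j * x $ j))\<^sup>2
      + (2 * \<beta> / q * (x $ i * x $ i) + 2 * \<beta> / q * (x $ j * x $ j) + q * (x $ i * x $ j))\<^sup>2
      + 2 * \<epsilon> * (1 * (x $ i * x $ j) + 0 * (x $ i * x $ j))\<^sup>2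
      = binary_quartic \<beta> \<gamma> (x $ i) (x $ j) - \<epsilon> * ((x $ i) ^ 4 + (x $ j) ^ 4)"
      unfolding s_def [symmetric] t_def [symmetric] sq r_def binary_quartic_def
      by (simp add: power2_eq_square power3_eq_cube power4_eq_xxxx algebra_simps)
  qed
  finally show ?thesis
    using that \<epsilon> by blast
qed


section \<open>Palindromic generating vectors\<close>

lemma vector_4:
  "(vector [a, b, c, d] :: ('a::zero)^4) $ 1 = a"
  "(vector [a, b, c, d] :: ('a::zero)^4) $ 2 = b"
  "(vector [a, b, c, d] :: ('a::zero)^4) $ 3 = c"
  "(vector [a, b, c, d] :: ('a::zero)^4) $ 4 = d"
  unfolding vector_def by simp_all

definition palindromic :: "real \<Rightarrow> real \<Rightarrow> real \<Rightarrow> real \<Rightarrow> real \<Rightarrow> real \<Rightarrow> tensor4" where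
  "palindromic v2 v6 v1 v3 v5 v0 = hankel_tensor [v0, v1, v2, v3, 1, v5, v6, v5, 1, v3, v2, v1, v0]"

text \<open>The monomials other than \<open>(x $ 1) ^ 4\<close> and \<open>(x $ 4) ^ 4\<close> that
  involve \<open>x $ 1\<close> or \<open>x $ 4\<close>. Such a variable is written first so that
  \<open>absorbable_monomial\<close> applies termwise.\<close>

definition palindromic_remainder ::
    "real \<Rightarrow> real \<Rightarrow> real \<Rightarrow> real \<Rightarrow> real \<Rightarrow> real^4 \<Rightarrow> real" where
  "palindromic_remainder v2 v6 v1 v3 v5 x =
     4 * v1 * (x $ 1 * x $ 1 * x $ 1 * x $ 2)
   + 4 * v2 * (x $ 1 * x $ 1 * x $ 1 * x $ 3) + 6 * v2 * (x $ 1 * x $ 1 * x $ 2 * x $ 2)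
   + 4 * v3 * (x $ 1 * x $ 1 * x $ 1 * x $ 4) + 12 * v3 * (x $ 1 * x $ 1 * x $ 2 * x $ 3)
   + 4 * v3 * (x $ 1 * x $ 2 * x $ 2 * x $ 2)
   + 12 * (x $ 1 * x $ 1 * x $ 2 * x $ 4) + 6 * (x $ 1 * x $ 1 * x $ 3 * x $ 3)
   + 12 * (x $ 1 * x $ 2 * x $ 2 * x $ 3)
   + 12 * v5 * (x $ 1 * x $ 1 * x $ 3 * x $ 4) + 12 * v5 * (x $ 1 * x $ 2 * x $ 2 * x $ 4)
   + 12 * v5 * (x $ 1 * x $ 2 * x $ 3 * x $ 3)
   + 6 * v6 * (x $ 1 * x $ 1 * x $ 4 * x $ 4) + 24 * v6 * (x $ 1 * x $ 2 * x $ 3 * x $ 4)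
   + 4 * v6 * (x $ 1 * x $ 3 * x $ 3 * x $ 3) + 4 * v6 * (x $ 4 * x $ 2 * x $ 2 * x $ 2)
   + 12 * v5 * (x $ 4 * x $ 4 * x $ 2 * x $ 1) + 12 * v5 * (x $ 4 * x $ 3 * x $ 3 * x $ 1)
   + 12 * v5 * (x $ 4 * x $ 3 * x $ 2 * x $ 2)
   + 12 * (x $ 4 * x $ 4 * x $ 3 * x $ 1) + 6 * (x $ 4 * x $ 4 * x $ 2 * x $ 2)
   + 12 * (x $ 4 * x $ 3 * x $ 3 * x $ 2)
   + 4 * v3 * (x $ 4 * x $ 4 * x $ 4 * x $ 1) + 12 * v3 * (x $ 4 * x $ 4 * x $ 3 * x $ 2)
   + 4 * v3 * (x $ 4 * x $ 3 * x $ 3 * x $ 3)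
   + 4 * v2 * (x $ 4 * x $ 4 * x $ 4 * x $ 2) + 6 * v2 * (x $ 4 * x $ 4 * x $ 3 * x $ 3)
   + 4 * v1 * (x $ 4 * x $ 4 * x $ 4 * x $ 3)"

lemma absorbable_palindromic_remainder: "absorbable (palindromic_remainder v2 v6 v1 v3 v5)"
  unfolding palindromic_remainder_def [abs_def]
  by (intro absorbable_add; rule absorbable_monomial, simp)

lemma tensor_poly_palindromic:
  "tensor_poly (palindromic v2 v6 v1 v3 v5 v0) x = v0 * ((x $ 1) ^ 4 + (x $ 4) ^ 4)
     + binary_quartic v5 v6 (x $ 2) (x $ 3) + palindromic_remainder v2 v6 v1 v3 v5 x"
  unfolding palindromic_def tensor_poly_hankel palindromic_remainder_def binary_quartic_def Let_def
  by (simp add: power2_eq_square power3_eq_cube power4_eq_xxxx algebra_simps)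

lemma tensor_poly_palindromic_shift:
  "tensor_poly (palindromic v2 v6 v1 v3 v5 (v0 + d)) x =
     tensor_poly (palindromic v2 v6 v1 v3 v5 v0) x + d * ((x $ 1) ^ 4 + (x $ 4) ^ 4)"
  unfolding tensor_poly_palindromic by (simp add: algebra_simps)

lemma sum_of_squares_fourth_powers_1_4: "sum_of_squares (\<lambda>x :: real^4. (x $ 1) ^ 4 + (x $ 4) ^ 4)"
  using sum_of_squares_fourth_powers [of "\<lambda>m :: 4. if m = 1 \<or> m = 4 then 1 else 0"]
  by (simp add: sum_4)

lemma SOS_palindromic_mono:
  assumes "SOS (palindromic v2 v6 v1 v3 v5 v0)" "v0 \<le> w0"
  shows "SOS (palindromic v2 v6 v1 v3 v5 w0)"
proof -
  have eq: "tensor_poly (palindromic v2 v6 v1 v3 v5 w0) = (\<lambda>x.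
      tensor_poly (palindromic v2 v6 v1 v3 v5 v0) x + (w0 - v0) * ((x $ 1) ^ 4 + (x $ 4) ^ 4))"
    using tensor_poly_palindromic_shift [of v2 v6 v1 v3 v5 v0 "w0 - v0"] by (simp add: fun_eq_iff)
  show ?thesis
    using assms unfolding SOS_iff eq
    by (intro sum_of_squares_add sum_of_squares_scale sum_of_squares_fourth_powers_1_4) simp_all
qed

lemma PSD_palindromic_mono:
  assumes "PSD (palindromic v2 v6 v1 v3 v5 v0)" "v0 \<le> w0"
  shows "PSD (palindromic v2 v6 v1 v3 v5 w0)"
  unfolding PSD_def
proof
  fix x :: "real^4"
  have "0 \<le> (w0 - v0) * ((x $ 1) ^ 4 + (x $ 4) ^ 4)"
    using assms(2) by simp
  then show "0 \<le> tensor_poly (palindromic v2 v6 v1 v3 v5 w0) x"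
    using assms(1) tensor_poly_palindromic_shift [of v2 v6 v1 v3 v5 v0 "w0 - v0" x]
    by (simp add: PSD_def)
qed

lemma SOS_limit:
  assumes "\<And>n. SOS (A n)" "\<And>x. (\<lambda>n. tensor_poly (A n) x) \<longlonglongrightarrow> tensor_poly B x"
  shows "SOS B"
  using sum_of_squares_limit [of "\<lambda>n. tensor_poly (A n)"] assms by (simp add: SOS_iff)

lemma tendsto_tensor_poly_palindromic:
  assumes "X \<longlonglongrightarrow> v0"
  shows "(\<lambda>n. tensor_poly (palindromic v2 v6 v1 v3 v5 (X n)) x)
    \<longlonglongrightarrow> tensor_poly (palindromic v2 v6 v1 v3 v5 v0) x"
  unfolding tensor_poly_palindromic by (intro tendsto_intros assms)

lemma closed_SOS_palindromic: "closed {v0. SOS (palindromic v2 v6 v1 v3 v5 v0)}"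
  unfolding closed_sequential_limits mem_Collect_eq
  by (intro allI impI, elim conjE) (rule SOS_limit [OF _ tendsto_tensor_poly_palindromic], auto)

lemma closed_PSD_palindromic: "closed {v0. PSD (palindromic v2 v6 v1 v3 v5 v0)}"
  unfolding closed_sequential_limits PSD_def mem_Collect_eq
  by (intro allI impI, elim conjE) (rule LIMSEQ_le_const [OF tendsto_tensor_poly_palindromic], auto)

text \<open>The slack of the middle quartic pays exactly for the \<open>\<epsilon>\<close> spent on
  absorbing the remainder; the constant \<open>C\<close> serves as \<open>v0\<close>.\<close>

lemma SOS_palindromic_exists:
  assumes "eta v5 v6 < 1"
  shows "\<exists>v0. SOS (palindromic v2 v6 v1 v3 v5 v0)"
proof -
  obtain \<epsilon> where \<epsilon>: "\<epsilon> > 0" "sum_of_squares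
      (\<lambda>x :: real^4. binary_quartic v5 v6 (x $ 2) (x $ 3) - \<epsilon> * ((x $ 2) ^ 4 + (x $ 3) ^ 4))"
    using binary_quartic_sum_of_squares [OF assms] .
  obtain C where C: "sum_of_squares (\<lambda>x. C * ((x $ 1) ^ 4 + (x $ 4) ^ 4)
      + \<epsilon> * ((x $ 2) ^ 4 + (x $ 3) ^ 4) + palindromic_remainder v2 v6 v1 v3 v5 x)"
    using absorbable_palindromic_remainder \<epsilon>(1) unfolding absorbable_def by meson
  have eq: "tensor_poly (palindromic v2 v6 v1 v3 v5 C) = (\<lambda>x.
      (binary_quartic v5 v6 (x $ 2) (x $ 3) - \<epsilon> * ((x $ 2) ^ 4 + (x $ 3) ^ 4))
      + (C * ((x $ 1) ^ 4 + (x $ 4) ^ 4)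
      + \<epsilon> * ((x $ 2) ^ 4 + (x $ 3) ^ 4) + palindromic_remainder v2 v6 v1 v3 v5 x))"
    by (simp add: fun_eq_iff tensor_poly_palindromic)
  have "SOS (palindromic v2 v6 v1 v3 v5 C)"
    unfolding SOS_iff eq by (rule sum_of_squares_add [OF \<epsilon>(2) C])
  then show ?thesis ..
qed

section \<open>Positivity of \<open>v0\<close> for PSD tensors\<close>

lemma nonneg_quartic_low_coeffs:
  fixes a b c d :: real
  assumes nonneg: "\<And>t. 0 \<le> a * t + b * t\<^sup>2 + c * t ^ 3 + d * t ^ 4"
  shows "a = 0" "0 \<le> b"
proof -
  \<comment> \<open>One-sided version: divide by \<open>t\<close> and let \<open>t\<close> tend to 0
    from the right. It is applied to the polynomial, to its reflection, and, once
    \<open>a = 0\<close>, to the quotient by \<open>t\<close>.\<close>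
  have a: "0 \<le> a" if nonneg: "\<And>t :: real. t > 0 \<Longrightarrow> 0 \<le> a * t + b * t\<^sup>2 + c * t ^ 3 + d * t ^ 4"
    for a b c d :: real
  proof (rule tendsto_lowerbound)
    show "((\<lambda>t. a + b * t + c * t\<^sup>2 + d * t ^ 3) \<longlongrightarrow> a) (at_right 0)"
      by (auto intro!: tendsto_eq_intros)
    show "\<forall>\<^sub>F t in at_right 0. 0 \<le> a + b * t + c * t\<^sup>2 + d * t ^ 3"
      using eventually_at_right_less [of "0 :: real"]
    proof eventually_elim
      case (elim t)
      have "0 \<le> (a + b * t + c * t\<^sup>2 + d * t ^ 3) * t"
        using nonneg [OF elim] by (simp add: algebra_simps power2_eq_square power3_eq_cube power4_eq_xxxx)
      then show ?case
        using elim by (simp add: zero_le_mult_iff)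
    qed
  qed simp
  have "0 \<le> a"
    using a [of a b c d] nonneg by blast
  moreover have "0 \<le> - a"
    using a [of "- a" b "- c" d] nonneg [of "- _"] by simp
  ultimately show "a = 0"
    by simp
  show "0 \<le> b"
  proof (rule a [of b c d 0])
    fix t :: real
    assume "t > 0"
    have "0 \<le> (b * t + c * t\<^sup>2 + d * t ^ 3 + 0 * t ^ 4) * t"
      using nonneg [of t] \<open>a = 0\<close>
      by (simp add: algebra_simps power2_eq_square power3_eq_cube power4_eq_xxxx)
    then show "0 \<le> b * t + c * t\<^sup>2 + d * t ^ 3 + 0 * t ^ 4"
      using \<open>t > 0\<close> by (simp add: zero_le_mult_iff)
  qed
qed

text \<open>Otherwise \<open>v0\<close> may be raised to 0, and the form vanishes at the first basis
  vector, which is then a minimum. The first-order condition forces \<open>v2 = 0\<close>, and the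
  second-order one fails.\<close>

lemma PSD_palindromic_imp_pos:
  assumes "PSD (palindromic v2 v6 v1 v3 v5 v0)"
  shows "0 < v0"
proof (rule ccontr)
  assume "\<not> 0 < v0"
  then have psd: "PSD (palindromic v2 v6 v1 v3 v5 0)"
    using PSD_palindromic_mono [OF assms] by simp
  \<comment> \<open>The form along the line \<open>(1, t * b, t * c, t * d)\<close>, ordered by
    powers of \<open>t\<close>.\<close>
  have expand: "0 \<le> 4 * (v1 * b + v2 * c + v3 * d) * t
      + 6 * (v2 * b\<^sup>2 + 2 * v3 * b * c + 2 * b * d + c\<^sup>2 + 2 * v5 * c * d + v6 * d\<^sup>2) * t\<^sup>2
      + 4 * (v3 * b ^ 3 + 3 * b\<^sup>2 * c + 3 * v5 * b\<^sup>2 * d + 3 * v5 * b * c\<^sup>2 + 6 * v6 * b * c * d + v6 * c ^ 3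
        + 3 * v5 * b * d\<^sup>2 + 3 * v5 * c\<^sup>2 * d + 3 * c * d\<^sup>2 + v3 * d ^ 3) * t ^ 3
      + tensor_poly (palindromic v2 v6 v1 v3 v5 0) (vector [0, b, c, d]) * t ^ 4" for b c d t
    using psd [unfolded PSD_def, rule_format, of "vector [1, t * b, t * c, t * d]"]
    unfolding tensor_poly_palindromic palindromic_remainder_def binary_quartic_def vector_4
    by (simp add: power2_eq_square power3_eq_cube power4_eq_xxxx algebra_simps)
  note low = nonneg_quartic_low_coeffs [OF expand]
  have "v2 = 0"
    using low(1) [of 0 1 0] by simp
  then show False
    \<comment> \<open>With \<open>c = 0\<close> and \<open>d = 1\<close> the second-order
      coefficient is \<open>6 * (2 * b + v6)\<close>, negative for this \<open>b\<close>; the term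
      \<open>2 * b\<close> stems from the normalization of the fifth entry to 1.\<close>
    using low(2) [of "- \<bar>v6\<bar> - 1" 0 1] by (simp add: abs_if split: if_splits)
qed

lemma mem_iff_Inf_le:
  fixes S :: "real set"
  assumes "closed S" "S \<noteq> {}" "bdd_below S" "\<And>x y. x \<in> S \<Longrightarrow> x \<le> y \<Longrightarrow> y \<in> S"
  shows "x \<in> S \<longleftrightarrow> Inf S \<le> x"
proof
  assume "x \<in> S"
  then show "Inf S \<le> x"
    using assms(3) by (rule cInf_lower)
next
  assume "Inf S \<le> x"
  moreover have "Inf S \<in> S"
    using assms(2,3,1) by (rule closed_contains_Inf)
  ultimately show "x \<in> S"
    using assms(4) by blast
qed

section \<open>Reduction of palindromic vectors to normalized ones\<close>

lemma tensor_poly_hankel_scale: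
  assumes "length v = 13"
  shows "tensor_poly (hankel_tensor (map ((*) c) v)) x = c * tensor_poly (hankel_tensor v) x"
  unfolding tensor_poly_hankel Let_def using assms by (simp add: algebra_simps)

text \<open>The perturbation is the palindromic Hankel tensor of the measure with masses \<open>e\<close> at \<open>1\<close>
  and \<open>-1\<close>, whose moments are \<open>2 e\<close> and \<open>0\<close> alternately; it makes the middle binary quartic
  positive definite.\<close>

lemma tensor_poly_hankel_perturb:
  assumes "\<forall>j\<le>5. v ! j = v ! (12 - j)" and c: "c = v ! 4 + 2 * e" "c \<noteq> 0"
  shows "tensor_poly (hankel_tensor v) x + e * ((x $ 1 + x $ 2 + x $ 3 + x $ 4) ^ 4
      + (x $ 1 - x $ 2 + x $ 3 - x $ 4) ^ 4)
    = c * tensor_poly (palindromic ((v ! 2 + 2 * e) / c) ((v ! 6 + 2 * e) / c)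
       (v ! 1 / c) (v ! 3 / c) (v ! 5 / c) ((v ! 0 + 2 * e) / c)) x"
proof -
  have sym: "v ! 12 = v ! 0" "v ! 11 = v ! 1" "v ! 10 = v ! 2" "v ! 9 = v ! 3" "v ! 8 = v ! 4" "v ! 7 = v ! 5"
    using assms(1)[rule_format, of 0] assms(1)[rule_format, of 1] assms(1)[rule_format, of 2]
      assms(1)[rule_format, of 3] assms(1)[rule_format, of 4] assms(1)[rule_format, of 5] by simp_all
  have scale: "c * tensor_poly (palindromic (a2 / c) (a6 / c) (a1 / c) (a3 / c) (a5 / c) (a0 / c)) x
     = tensor_poly (hankel_tensor [a0, a1, a2, a3, c, a5, a6, a5, c, a3, a2, a1, a0]) x"
     for a0 a1 a2 a3 a5 a6
    using tensor_poly_hankel_scale [of "[a0 / c, a1 / c, a2 / c, a3 / c, 1, a5 / c, a6 / c, a5 / c, 1,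
        a3 / c, a2 / c, a1 / c, a0 / c]" c x] c(2)
    by (simp add: palindromic_def)
  show ?thesis
    unfolding scale unfolding c(1) tensor_poly_hankel Let_def
    by (simp add: sym power2_eq_square power3_eq_cube power4_eq_xxxx algebra_simps)
qed

text \<open>On the middle plane the perturbation adds
  \<open>e * ((s + t) ^ 4 + (t - s) ^ 4)\<close>, positive off the origin, so the nonnegative
  restriction becomes positive and \<open>eta_less_1I\<close> applies.\<close>

lemma perturbed_eta_less_1:
  assumes "\<forall>j\<le>5. v ! j = v ! (12 - j)" "PSD (hankel_tensor v)" "e > 0"
  shows "v ! 4 + 2 * e > 0" "eta (v ! 5 / (v ! 4 + 2 * e)) ((v ! 6 + 2 * e) / (v ! 4 + 2 * e)) < 1"
proof -
  have "tensor_poly (hankel_tensor v) (vector [0, 1, 0, 0]) = v ! 4"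
    by (simp add: tensor_poly_hankel Let_def vector_4)
  then have "v ! 4 \<ge> 0"
    using assms(2) unfolding PSD_def by metis
  then show c: "v ! 4 + 2 * e > 0"
    using assms(3) by simp
  show "eta (v ! 5 / (v ! 4 + 2 * e)) ((v ! 6 + 2 * e) / (v ! 4 + 2 * e)) < 1"
  proof (rule eta_less_1I)
    fix s t :: real
    assume st: "(s, t) \<noteq> (0, 0)"
    let ?x = "vector [0, s, t, 0] :: real^4"
    have "(s + t) ^ 4 + (t - s) ^ 4 > 0"
    proof -
      have "s + t \<noteq> 0 \<or> t - s \<noteq> 0"
        using st by auto
      then show ?thesis
        by (auto intro: add_pos_nonneg add_nonneg_pos)
    qed
    then have "0 < e * ((s + t) ^ 4 + (t - s) ^ 4)"
      using assms(3) by simp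
    moreover have "0 \<le> tensor_poly (hankel_tensor v) ?x"
      using assms(2) by (simp add: PSD_def)
    ultimately have "0 < tensor_poly (hankel_tensor v) ?x + e * ((s + t) ^ 4 + (t - s) ^ 4)"
      by linarith
    also have "\<dots> = (v ! 4 + 2 * e) * binary_quartic (v ! 5 / (v ! 4 + 2 * e)) ((v ! 6 + 2 * e) / (v ! 4 + 2 * e)) s t"
      using tensor_poly_hankel_perturb [OF assms(1) refl, of e ?x] c
      by (simp add: tensor_poly_palindromic palindromic_remainder_def vector_4)
    finally show "0 < binary_quartic (v ! 5 / (v ! 4 + 2 * e)) ((v ! 6 + 2 * e) / (v ! 4 + 2 * e)) s t"
      using c by (simp add: zero_less_mult_iff)
  qed
qed

lemma PSD_imp_SOS_palindromic:
  assumes v: "\<forall>j\<le>5. v ! j = v ! (12 - j)" "PSD (hankel_tensor v)"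
    and normalized: "\<And>v2 v6 v1 v3 v5 v0. eta v5 v6 < 1 \<Longrightarrow> PSD (palindromic v2 v6 v1 v3 v5 v0)
      \<Longrightarrow> SOS (palindromic v2 v6 v1 v3 v5 v0)"
  shows "SOS (hankel_tensor v)"
proof -
  let ?w = "\<lambda>x :: real^4. (x $ 1 + x $ 2 + x $ 3 + x $ 4) ^ 4 + (x $ 1 - x $ 2 + x $ 3 - x $ 4) ^ 4"
  have sos: "sum_of_squares (\<lambda>x. tensor_poly (hankel_tensor v) x + e * ?w x)" if e: "e > 0" for e
  proof -
    define c where "c = v ! 4 + 2 * e"
    define A where "A = palindromic ((v ! 2 + 2 * e) / c) ((v ! 6 + 2 * e) / c) (v ! 1 / c) (v ! 3 / c)
      (v ! 5 / c) ((v ! 0 + 2 * e) / c)"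
    have c: "c > 0" and eta: "eta (v ! 5 / c) ((v ! 6 + 2 * e) / c) < 1"
      using perturbed_eta_less_1 [OF v e] by (simp_all add: c_def)
    have eq: "tensor_poly (hankel_tensor v) x + e * ?w x = c * tensor_poly A x" for x
      using tensor_poly_hankel_perturb [OF v(1), of c e x] c by (simp add: A_def c_def)
    have "0 \<le> c * tensor_poly A x" for x
      unfolding eq [symmetric] using v(2) e by (simp add: PSD_def)
    then have "PSD A"
      using c by (simp add: PSD_def zero_le_mult_iff)
    then have "sum_of_squares (tensor_poly A)"
      using normalized [OF eta] by (simp add: A_def SOS_iff)
    then show ?thesis
      unfolding eq using c by (intro sum_of_squares_scale) simp_all
  qed
  have "sum_of_squares (tensor_poly (hankel_tensor v))"
  proof (rule sum_of_squares_limit)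
    show "sum_of_squares (\<lambda>x. tensor_poly (hankel_tensor v) x + inverse (real (Suc n)) * ?w x)" for n
      by (rule sos) simp
    show "(\<lambda>n. tensor_poly (hankel_tensor v) x + inverse (real (Suc n)) * ?w x)
      \<longlonglongrightarrow> tensor_poly (hankel_tensor v) x" for x
      using tendsto_add [OF tendsto_const tendsto_mult_right [OF LIMSEQ_inverse_real_of_nat, of "?w x"],
          of "tensor_poly (hankel_tensor v) x"]
      by simp
  qed
  then show ?thesis
    by (simp add: SOS_iff)
qed

theorem theorem5:
  "\<exists>(M0 :: real \<Rightarrow> real \<Rightarrow> real \<Rightarrow> real \<Rightarrow> real \<Rightarrow> real)
    (N0 :: real \<Rightarrow> real \<Rightarrow> real \<Rightarrow> real \<Rightarrow> real \<Rightarrow> real).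
     (\<forall>v2 v6 v1 v3 v5. eta v5 v6 < 1 \<longrightarrow>
        M0 v2 v6 v1 v3 v5 \<ge> N0 v2 v6 v1 v3 v5 \<and> N0 v2 v6 v1 v3 v5 > 0 \<and>
        (\<forall>v0.
           (SOS (hankel_tensor [v0, v1, v2, v3, 1, v5, v6, v5, 1, v3, v2, v1, v0])
              \<longleftrightarrow> v0 \<ge> M0 v2 v6 v1 v3 v5) \<and>
           (PSD (hankel_tensor [v0, v1, v2, v3, 1, v5, v6, v5, 1, v3, v2, v1, v0])
              \<longleftrightarrow> v0 \<ge> N0 v2 v6 v1 v3 v5))) \<and>
     ((\<forall>v2 v6 v1 v3 v5. eta v5 v6 < 1 \<longrightarrow> M0 v2 v6 v1 v3 v5 = N0 v2 v6 v1 v3 v5) \<longrightarrow>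
        \<not> (\<exists>v :: real list. length v = 13 \<and> (\<forall>j \<le> 5. v ! j = v ! (12 - j)) \<and>
              PNS (hankel_tensor v)))"
proof -
  \<comment> \<open>For \<open>eta v5 v6 < 1\<close> these infima are attained; elsewhere nothing is
    claimed about them.\<close>
  define M0 where "M0 v2 v6 v1 v3 v5 = Inf {v0. SOS (palindromic v2 v6 v1 v3 v5 v0)}" for v2 v6 v1 v3 v5
  define N0 where "N0 v2 v6 v1 v3 v5 = Inf {v0. PSD (palindromic v2 v6 v1 v3 v5 v0)}" for v2 v6 v1 v3 v5
  have M0: "SOS (palindromic v2 v6 v1 v3 v5 v0) \<longleftrightarrow> M0 v2 v6 v1 v3 v5 \<le> v0"
    and N0: "PSD (palindromic v2 v6 v1 v3 v5 v0) \<longleftrightarrow> N0 v2 v6 v1 v3 v5 \<le> v0"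
    if eta: "eta v5 v6 < 1" for v2 v6 v1 v3 v5 v0
  proof -
    let ?S = "{v0. SOS (palindromic v2 v6 v1 v3 v5 v0)}" and ?P = "{v0. PSD (palindromic v2 v6 v1 v3 v5 v0)}"
    have "?S \<noteq> {}"
      using SOS_palindromic_exists [OF eta] by blast
    \<comment> \<open>The inclusion passes nonemptiness up to \<open>?P\<close> and the lower bound
      down to \<open>?S\<close>.\<close>
    moreover have "?S \<subseteq> ?P"
      by (auto intro: SOS_imp_PSD)
    moreover have "bdd_below ?P"
      by (rule bdd_belowI [of _ 0]) (auto dest: PSD_palindromic_imp_pos)
    ultimately have "?P \<noteq> {}" "bdd_below ?S"
      by (blast, metis bdd_below_mono)
    have "v0 \<in> ?S \<longleftrightarrow> Inf ?S \<le> v0"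
      using closed_SOS_palindromic \<open>?S \<noteq> {}\<close> \<open>bdd_below ?S\<close>
      by (rule mem_iff_Inf_le) (auto intro: SOS_palindromic_mono)
    then show "SOS (palindromic v2 v6 v1 v3 v5 v0) \<longleftrightarrow> M0 v2 v6 v1 v3 v5 \<le> v0"
      by (simp add: M0_def)
    have "v0 \<in> ?P \<longleftrightarrow> Inf ?P \<le> v0"
      using closed_PSD_palindromic \<open>?P \<noteq> {}\<close> \<open>bdd_below ?P\<close>
      by (rule mem_iff_Inf_le) (auto intro: PSD_palindromic_mono)
    then show "PSD (palindromic v2 v6 v1 v3 v5 v0) \<longleftrightarrow> N0 v2 v6 v1 v3 v5 \<le> v0"
      by (simp add: N0_def)
  qed
  show ?thesis
    unfolding palindromic_def [symmetric]
  proof (rule exI [of _ M0], rule exI [of _ N0], intro conjI allI impI notI)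
    fix v2 v6 v1 v3 v5 :: real
    assume eta: "eta v5 v6 < 1"
    \<comment> \<open>The equivalences are instantiated at \<open>M0\<close> itself, and below for
      positivity at \<open>N0\<close> itself.\<close>
    show "N0 v2 v6 v1 v3 v5 \<le> M0 v2 v6 v1 v3 v5"
      using M0 [OF eta] N0 [OF eta] SOS_imp_PSD by blast
    show "0 < N0 v2 v6 v1 v3 v5"
      using N0 [OF eta] PSD_palindromic_imp_pos by blast
    show "SOS (palindromic v2 v6 v1 v3 v5 v0) \<longleftrightarrow> M0 v2 v6 v1 v3 v5 \<le> v0"
      "PSD (palindromic v2 v6 v1 v3 v5 v0) \<longleftrightarrow> N0 v2 v6 v1 v3 v5 \<le> v0" for v0
      using M0 [OF eta] N0 [OF eta] by auto
  next
    assume "\<forall>v2 v6 v1 v3 v5. eta v5 v6 < 1 \<longrightarrow> M0 v2 v6 v1 v3 v5 = N0 v2 v6 v1 v3 v5"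
    then have "SOS (palindromic v2 v6 v1 v3 v5 v0)"
      if "eta v5 v6 < 1" "PSD (palindromic v2 v6 v1 v3 v5 v0)" for v2 v6 v1 v3 v5 v0
      using that M0 N0 by simp
    moreover assume "\<exists>v. length v = 13 \<and> (\<forall>j\<le>5. v ! j = v ! (12 - j)) \<and> PNS (hankel_tensor v)"
    ultimately show False
      using PSD_imp_SOS_palindromic unfolding PNS_def by blast
  qed
qed

end
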